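(* Let $R$ be a rational function and let $f=R'$ be an exact rational function of degree at most two. (a) If $\deg f=1$, then $f$ is a nonconstant polynomial of degree one. Hence $\mathfrak{I}_R$ is an affine real line. (b) If $\deg f=2$, then exactly one of the following occurs. (i) $f$ is a quadratic polynomial. After translation and complex scaling of the source coordinate it has the form $f(z)=\alpha z^2+\beta$ with $\alpha\neq0$. The inflection curve $\mathfrak{I}_R$ is affinely equivalent to $2xy+\operatorname{Im}\beta=0$. Thus it is a smooth hyperbola if $\operatorname{Im}\beta\neq0$, and the union of two transverse lines if $\operatorname{Im}\beta=0$. (ii) $f$ has one finite pole, necessarily of order two. Then $f(z)=\beta+\dfrac{\alpha}{(z-p)^2}$ with $\alpha\neq0$. In the coordinate $u=1/(z-p)$ the inflection curve is again affinely equivalent to $2xy+\operatorname{Im}\beta=0$. In the $z$-sphere, the point $p$ is an ordinary real node of the projective dessin $f^{-1}(\mathbb{RP}^1)$.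
   Context: $\deg f$ is the degree of $f$ as a rational map $\mathbb{CP}^1\to\mathbb{CP}^1$. A rational function $f$ is exact if $f=R'$ for some rational function $R$, equivalently if $f(z)\,dz$ has zero residues. The affine inflection curve $\mathfrak{I}_R$ is, for $R=Q/P$ in lowest terms, the closure in $\mathbb{C}$ of $\{z\in\mathbb{C}: R(z)\neq0,\ P(z)\neq0,\ \operatorname{Im}R'(z)=0\}$; the projective dessin is $f^{-1}(\mathbb{RP}^1)\subset\mathbb{CP}^1$, with $\mathbb{RP}^1=\mathbb{R}\cup\{\infty\}$. An ordinary real node is a point at which the curve locally consists of exactly two smooth real branches crossing transversally. *)

theory Defs
  imports "HOL-Analysis.Analysis" "HOL-Computational_Algebra.Computational_Algebra"
    "HOL-Computational_Algebra.Field_as_Ring"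
begin

type_synonym ratfun = "complex poly fract"

text \<open>\<open>quot_of_fract\<close> returns the representation in lowest terms (with monic denominator).\<close>

definition rat_num :: "ratfun \<Rightarrow> complex poly" where
  "rat_num f = fst (quot_of_fract f)"

definition rat_den :: "ratfun \<Rightarrow> complex poly" where
  "rat_den f = snd (quot_of_fract f)"

definition rat_degree :: "ratfun \<Rightarrow> nat" where
  "rat_degree f = max (degree (rat_num f)) (degree (rat_den f))"

definition rat_deriv :: "ratfun \<Rightarrow> ratfun" where
  "rat_deriv f =
     Fract (pderiv (rat_num f) * rat_den f - rat_num f * pderiv (rat_den f)) ((rat_den f)\<^sup>2)"

definition finite_poles :: "ratfun \<Rightarrow> complex set" where
  "finite_poles f = {z. poly (rat_den f) z = 0}"

definition pole_order :: "ratfun \<Rightarrow> complex \<Rightarrow> nat" where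
  "pole_order f p = order p (rat_den f)"

text \<open>The value at a point that is not a finite pole; at a finite pole it is the junk value \<open>0\<close>.\<close>

definition rat_eval :: "ratfun \<Rightarrow> complex \<Rightarrow> complex" where
  "rat_eval f z = poly (rat_num f) z / poly (rat_den f) z"

definition inflection_curve :: "ratfun \<Rightarrow> complex set" where
  "inflection_curve R =
     closure {z. poly (rat_num R) z \<noteq> 0 \<and> poly (rat_den R) z \<noteq> 0 \<and>
                 Im (rat_eval (rat_deriv R) z) = 0}"

text \<open>The complex projective line is \<open>complex option\<close>, with \<open>None\<close> as the point at infinity.\<close>

definition rat_map :: "ratfun \<Rightarrow> complex option \<Rightarrow> complex option" where
  "rat_map f w = (case w of
       Some z \<Rightarrow> if z \<in> finite_poles f then None else Some (rat_eval f z)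
     | None \<Rightarrow>
         if degree (rat_num f) > degree (rat_den f) then None
         else Some (coeff (rat_num f) (degree (rat_den f)) / lead_coeff (rat_den f)))"

definition real_proj_line :: "complex option set" where
  "real_proj_line = insert None (Some ` \<real>)"

definition projective_dessin :: "ratfun \<Rightarrow> complex option set" where
  "projective_dessin f = rat_map f -` real_proj_line"

definition real_line :: "'a::euclidean_space set \<Rightarrow> bool" where
  "real_line S \<longleftrightarrow> affine S \<and> aff_dim S = 1"

text \<open>In the real plane two lines are transverse iff they meet in exactly one point.\<close>

definition two_transverse_lines :: "complex set \<Rightarrow> bool" where
  "two_transverse_lines S \<longleftrightarrow>
     (\<exists>l m q. real_line l \<and> real_line m \<and> l \<inter> m = {q} \<and> S = l \<union> m)"

text \<open>
  A smooth hyperbola: the real zero set of a quadratic polynomial in \<open>x = Re z\<close>, \<open>y = Im z\<close> of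
  hyperbolic type (positive discriminant), nondegenerate (nonzero determinant of its homogeneous
  symmetric matrix, here multiplied by 4), and without singular points.
\<close>

definition smooth_hyperbola :: "complex set \<Rightarrow> bool" where
  "smooth_hyperbola S \<longleftrightarrow>
     (\<exists>a b c d e k :: real.
        b\<^sup>2 - 4 * a * c > 0 \<and>
        4 * a * c * k + b * d * e - a * e\<^sup>2 - c * d\<^sup>2 - k * b\<^sup>2 \<noteq> 0 \<and>
        S = {z. a * (Re z)\<^sup>2 + b * Re z * Im z + c * (Im z)\<^sup>2 + d * Re z + e * Im z + k = 0} \<and>
        (\<forall>z\<in>S. 2 * a * Re z + b * Im z + d \<noteq> 0 \<or> b * Re z + 2 * c * Im z + e \<noteq> 0))"

definition affinely_equivalent :: "'a::real_vector set \<Rightarrow> 'b::real_vector set \<Rightarrow> bool" where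
  "affinely_equivalent S T \<longleftrightarrow>
     (\<exists>L c. linear L \<and> bij L \<and> (\<lambda>z. L z + c) ` S = T)"

definition model_curve :: "complex \<Rightarrow> (real \<times> real) set" where
  "model_curve \<beta> = {(x, y). 2 * x * y + Im \<beta> = 0}"

text \<open>
  A plane curve \<open>S\<close> in the coordinate \<open>u = 1/(z - p)\<close>. This coordinate takes \<open>p\<close> to infinity and
  infinity to \<open>0\<close>, so for \<open>S\<close> closed in \<open>\<complex>\<close> the closure adds at most the point \<open>u = 0\<close>, which it
  does exactly when \<open>S\<close> is unbounded.
\<close>

definition in_inverse_coordinate :: "complex \<Rightarrow> complex set \<Rightarrow> complex set" where
  "in_inverse_coordinate p S = closure ((\<lambda>z. 1 / (z - p)) ` (S - {p}))"

text \<open>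
  \<open>D n\<close> is the \<open>n\<close>-th derivative of \<open>g\<close>. The homeomorphism condition makes the image an embedded
  arc, which excludes curves returning to their own interior points.
\<close>

definition smooth_branch :: "real set \<Rightarrow> (real \<Rightarrow> complex) \<Rightarrow> bool" where
  "smooth_branch I g \<longleftrightarrow>
     (\<exists>D :: nat \<Rightarrow> real \<Rightarrow> complex. D 0 = g \<and>
        (\<forall>n. \<forall>t\<in>I. (D n has_vector_derivative D (Suc n) t) (at t))) \<and>
     (\<forall>t\<in>I. vector_derivative g (at t) \<noteq> 0) \<and>
     (\<exists>h. homeomorphism I (g ` I) g h)"

definition ordinary_real_node :: "complex set \<Rightarrow> complex \<Rightarrow> bool" where
  "ordinary_real_node S p \<longleftrightarrow>
     (\<exists>U \<epsilon> g h. open U \<and> p \<in> U \<and> \<epsilon> > 0 \<and>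
        smooth_branch {-\<epsilon><..<\<epsilon>} g \<and> smooth_branch {-\<epsilon><..<\<epsilon>} h \<and>
        g 0 = p \<and> h 0 = p \<and>
        S \<inter> U = g ` {-\<epsilon><..<\<epsilon>} \<union> h ` {-\<epsilon><..<\<epsilon>} \<and>
        g ` {-\<epsilon><..<\<epsilon>} \<inter> h ` {-\<epsilon><..<\<epsilon>} = {p} \<and>
        vector_derivative g (at 0) \<noteq> vector_derivative h (at 0) \<and>
        independent {vector_derivative g (at 0), vector_derivative h (at 0)})"

text \<open>The part of a curve on the sphere that is visible in the chart \<open>z\<close>.\<close>

definition finite_part :: "complex option set \<Rightarrow> complex set" where
  "finite_part C = Some -` C"

end

(* Write R = Q/P in lowest terms and f = R' = N/D. At a root of P of order m, the polynomial
   Q' P - Q P' vanishes to order less than m, so D vanishes there to order more than m. Hence every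
   finite pole of f has order at least two, and in degree at most two f is either a polynomial or
   has a single double pole p with P = z - p. In the latter case N = Q' P - Q, so N' = Q'' P
   vanishes at p, which kills the residue.

   Removing finitely many points from {Im f = 0} does not change its closure: an isolated point of
   this set would contradict the open mapping theorem, because Im f would have constant sign on a
   punctured disc around it. So the inflection curve is {Im f = 0}, and a square root of the leading
   coefficient turns it into 2 x y + Im beta = 0. *)

theory Submission
  imports Defs "HOL-Complex_Analysis.Complex_Analysis"
begin

section \<open>Derivatives of rational functions\<close>

lemma rat_den_nonzero [simp]: "rat_den f \<noteq> 0"
  by (simp add: rat_den_def)

lemma coprime_rat: "coprime (rat_num f) (rat_den f)"
  by (simp add: rat_num_def rat_den_def coprime_quot_of_fract)

lemma Fract_rat: "Fract (rat_num f) (rat_den f) = f"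
  by (simp add: rat_num_def rat_den_def)

text \<open>\<open>quot_of_fract\<close> normalises the denominator to unit factor 1, and over a
  field the unit factor of a polynomial is its leading coefficient.\<close>

lemma lead_coeff_rat_den: "lead_coeff (rat_den f) = 1"
  using unit_factor_snd_quot_of_fract[of f]
  by (auto simp: rat_den_def unit_factor_poly_def one_pCons)

lemma rat_num_to_fract [simp]: "rat_num (to_fract q) = q"
  and rat_den_to_fract [simp]: "rat_den (to_fract q) = 1"
  by (simp_all add: rat_num_def rat_den_def quot_of_fract_to_fract)

lemma poly_rat_num_nonzero_at_pole:
  assumes "poly (rat_den f) p = 0"
  shows "poly (rat_num f) p \<noteq> 0"
proof
  assume "poly (rat_num f) p = 0"
  with assms have "[:-p, 1:] dvd rat_num f" "[:-p, 1:] dvd rat_den f"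
    by (simp_all add: poly_eq_0_iff_dvd)
  then have "is_unit [:-p, 1:]"
    using coprime_rat coprime_common_divisor by blast
  then show False
    by (simp add: is_unit_iff_degree)
qed

section \<open>Poles of a derivative\<close>

text \<open>The quotient rule gives a fraction that need not be reduced; cross-multiplication links
  it to the reduced numerator and denominator.\<close>

lemma rat_deriv_cross_mult:
  "rat_num (rat_deriv R) * (rat_den R)\<^sup>2 =
    (pderiv (rat_num R) * rat_den R - rat_num R * pderiv (rat_den R)) * rat_den (rat_deriv R)"
proof -
  have "Fract (rat_num (rat_deriv R)) (rat_den (rat_deriv R)) = rat_deriv R"
    by (rule Fract_rat)
  then show ?thesis
    unfolding rat_deriv_def[of R] by (subst (asm) eq_fract) auto
qed

text \<open>Let m be the order of P = \<open>rat_den R\<close> at p. Then Q' P is divisible by (z -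
  p)^m, while Q P' has order m - 1, so W = Q' P - Q P' has order below m. Comparing orders in N P^2
  = W D gives ord D \<ge> 2 m - ord W > m.\<close>

lemma order_pole_rat_deriv:
  assumes P0: "poly (rat_den R) p = 0"
  shows "order p (rat_den R) < order p (rat_den (rat_deriv R))"
proof -
  let ?N = "rat_num (rat_deriv R)" and ?D = "rat_den (rat_deriv R)"
  let ?Q = "rat_num R" and ?P = "rat_den R"
  let ?W = "pderiv ?Q * ?P - ?Q * pderiv ?P"
  have Q0: "poly ?Q p \<noteq> 0"
    using P0 by (rule poly_rat_num_nonzero_at_pole)
  have P': "order p ?P = Suc (order p (pderiv ?P))"
    using P0 by (simp add: order_pderiv)
  have P'nz: "pderiv ?P \<noteq> 0"
    using P0 rat_den_nonzero[of R] by (auto dest!: pderiv_iszero simp del: rat_den_nonzero)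
  have ndvd: "\<not> [:-p, 1:] ^ order p ?P dvd ?W"
  proof
    assume "[:-p, 1:] ^ order p ?P dvd ?W"
    moreover have "[:-p, 1:] ^ order p ?P dvd pderiv ?Q * ?P"
      by (simp add: order_1)
    ultimately have "[:-p, 1:] ^ order p ?P dvd pderiv ?Q * ?P - ?W"
      by (rule dvd_diff[rotated])
    then have "[:-p, 1:] ^ order p ?P dvd ?Q * pderiv ?P"
      by (simp only: diff_diff_eq2 add_diff_cancel_left')
    moreover have QP': "?Q * pderiv ?P \<noteq> 0"
      using Q0 P'nz by auto
    ultimately have "order p ?P \<le> order p (?Q * pderiv ?P)"
      by (simp add: order_divides)
    also have "\<dots> = order p (pderiv ?P)"
      using Q0 QP' by (subst order_mult) (auto simp: order_0I)
    finally show False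
      using P' by simp
  qed
  \<comment> \<open>Zero is divisible by every polynomial, so the failed divisibility also shows
    that W is nonzero.\<close>
  then have less: "order p ?W < order p ?P" and Wnz: "?W \<noteq> 0"
    by (auto simp: order_divides)
  then have "?W * ?D \<noteq> 0"
    by simp
  then have "?N * ?P\<^sup>2 \<noteq> 0" "order p (?N * ?P\<^sup>2) = order p ?W + order p ?D"
    by (simp_all add: rat_deriv_cross_mult order_mult del: mult_eq_0_iff)
  moreover from this have "order p (?N * ?P\<^sup>2) = order p ?N + 2 * order p ?P"
    by (auto simp: power2_eq_square order_mult)
  ultimately show ?thesis
    using less by simp
qed

text \<open>At a root of D the cross-multiplied identity reduces to N(p) P(p)^2 = 0 with N(p)
  nonzero. Conversely, at a root of P the order of D is positive.\<close>

lemma pole_rat_deriv_iff: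
  "poly (rat_den (rat_deriv R)) p = 0 \<longleftrightarrow> poly (rat_den R) p = 0"
proof
  assume D0: "poly (rat_den (rat_deriv R)) p = 0"
  then have "poly (rat_num (rat_deriv R)) p \<noteq> 0"
    by (rule poly_rat_num_nonzero_at_pole)
  with D0 arg_cong[OF rat_deriv_cross_mult[of R], of "\<lambda>q. poly q p"]
  show "poly (rat_den R) p = 0"
    by simp
next
  assume "poly (rat_den R) p = 0"
  then show "poly (rat_den (rat_deriv R)) p = 0"
    using order_pole_rat_deriv[of R p] by (metis gr_implies_not_zero order_0I)
qed

lemma monic_dvd_imp_eq:
  fixes A B :: "'a::idom poly"
  assumes "B dvd A" "degree A = degree B" "lead_coeff A = 1" "lead_coeff B = 1"
  shows "A = B"
proof -
  obtain C where C: "A = B * C" using assms(1) by blast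
  have "A \<noteq> 0" using assms(3) by auto
  then have "degree C = 0" using C assms(2) by (auto simp: degree_mult_eq)
  then obtain c where "C = [:c:]" by (rule degree_eq_zeroE)
  then show ?thesis using C assms by (auto simp: lead_coeff_mult)
qed

lemma degree_le_2E:
  assumes "degree p \<le> 2"
  obtains a b c where "p = [:a, b, c:]"
proof
  show "p = [:coeff p 0, coeff p 1, coeff p 2:]"
    using assms
    by (intro poly_eqI) (auto simp: coeff_pCons coeff_eq_0 numeral_2_eq_2 split: nat.splits)
qed

text \<open>A root of D has order at least two and D has degree at most two, so there is no room for
  a second root or for a simple pole. The form of \<open>rat_den R\<close> is recorded as well,
  because the residue computation uses it.\<close>

lemma rat_deriv_cases:
  assumes "rat_degree (rat_deriv R) \<le> 2"
  obtains (polynomial) q where "rat_deriv R = to_fract q" "degree q = rat_degree (rat_deriv R)"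
  | (double_pole) p where "rat_den (rat_deriv R) = [:-p, 1:]\<^sup>2" "rat_den R = [:-p, 1:]"
proof (cases "degree (rat_den (rat_deriv R)) = 0")
  case True
  then have "rat_den (rat_deriv R) = 1"
    using lead_coeff_rat_den[of "rat_deriv R"] by (auto elim!: degree_eq_zeroE simp: one_pCons)
  with Fract_rat[of "rat_deriv R"] have "rat_deriv R = to_fract (rat_num (rat_deriv R))"
    by (simp add: to_fract_def)
  then show ?thesis
    by (rule polynomial) (simp add: rat_degree_def \<open>rat_den (rat_deriv R) = 1\<close>)
next
  case False
  let ?D = "rat_den (rat_deriv R)" and ?P = "rat_den R"
  obtain p where p: "poly ?D p = 0"
    using False Fundamental_Theorem_Algebra.fundamental_theorem_of_algebra[of ?D] by (auto simp: constant_degree)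
  have P0: "poly ?P p = 0"
    using p by (simp add: pole_rat_deriv_iff)
  then have oP: "order p ?P > 0"
    by (simp add: order_gt_0_iff)
  have deg: "degree ?D \<le> 2"
    using assms by (simp add: rat_degree_def)
  \<comment> \<open>The order of P is at least 1, that of D is strictly larger and at most
    \<open>degree ?D\<close>, hence at most 2; all these bounds are therefore attained.\<close>
  with oP order_pole_rat_deriv[OF P0] order_degree[of ?D p]
  have o: "order p ?D = 2" and d: "degree ?D = 2" and o1: "order p ?P = 1"
    by auto
  have D: "?D = [:-p, 1:]\<^sup>2"
  proof (rule monic_dvd_imp_eq)
    show "[:-p, 1:]\<^sup>2 dvd ?D" using o by (metis order_1)
  qed (use d lead_coeff_rat_den[of "rat_deriv R"] in \<open>simp_all add: power2_eq_square\<close>)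
  obtain C where C: "?P = [:-p, 1:] * C" "\<not> [:-p, 1:] dvd C"
    using order_decomp[of ?P p] o1 by auto
  \<comment> \<open>A root of the cofactor would be a root of P, hence of D, hence equal to p, where
    C does not vanish.\<close>
  have "degree C = 0"
  proof (rule ccontr)
    assume "degree C \<noteq> 0"
    then obtain z where z: "poly C z = 0"
      using Fundamental_Theorem_Algebra.fundamental_theorem_of_algebra[of C] by (auto simp: constant_degree)
    then have "poly ?D z = 0"
      using C by (simp add: pole_rat_deriv_iff)
    then have "z = p"
      by (simp add: D)
    with z C(2) show False
      by (simp add: poly_eq_0_iff_dvd)
  qed
  then obtain c where "C = [:c:]"
    by (rule degree_eq_zeroE)
  with C(1) lead_coeff_rat_den[of R] have "?P = [:-p, 1:]"
    by (auto split: if_splits)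
  with D show ?thesis
    by (rule double_pole)
qed

text \<open>The vanishing residue makes \<open>p\<close> a critical point of the numerator, which is \<open>Q' P - Q\<close> here.\<close>

lemma rat_eval_double_pole:
  assumes D: "rat_den (rat_deriv R) = [:-p, 1:]\<^sup>2" and P: "rat_den R = [:-p, 1:]"
    and deg: "rat_degree (rat_deriv R) \<le> 2"
  obtains \<alpha> \<beta> where "\<alpha> \<noteq> 0"
    "\<And>z. z \<noteq> p \<Longrightarrow> rat_eval (rat_deriv R) z = \<beta> + \<alpha> / (z - p)\<^sup>2"
proof -
  let ?N = "rat_num (rat_deriv R)" and ?Q = "rat_num R"
  have "?N * [:-p, 1:]\<^sup>2 = (pderiv ?Q * [:-p, 1:] - ?Q) * [:-p, 1:]\<^sup>2"
    using rat_deriv_cross_mult[of R] unfolding D P by (simp add: pderiv_pCons)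
  then have N: "?N = pderiv ?Q * [:-p, 1:] - ?Q"
    by (subst (asm) mult_right_cancel) auto
  have N'p: "poly (pderiv ?N) p = 0"
    by (simp add: N pderiv_diff pderiv_mult pderiv_pCons pderiv_smult)
  have "degree ?N \<le> 2"
    using deg by (simp add: rat_degree_def)
  then obtain n0 n1 n2 where n: "?N = [:n0, n1, n2:]"
    by (rule degree_le_2E)
  have n1: "n1 = - 2 * n2 * p"
    using N'p by (simp add: n pderiv_pCons algebra_simps add_eq_0_iff)
  have "poly ?N p \<noteq> 0"
    by (rule poly_rat_num_nonzero_at_pole) (simp add: D)
  \<comment> \<open>The Taylor expansion of N at p has no linear term, so \<beta> is the leading
    coefficient \<open>n2\<close> and \<alpha> is N(p).\<close>
  moreover have "rat_eval (rat_deriv R) z = n2 + poly ?N p / (z - p)\<^sup>2" if "z \<noteq> p" for z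
  proof -
    have "poly ?N z = n2 * (z - p)\<^sup>2 + poly ?N p"
      by (simp add: n n1 algebra_simps power2_eq_square)
    then show ?thesis
      using that by (simp add: rat_eval_def D add_divide_distrib)
  qed
  ultimately show ?thesis
    by (rule that)
qed

section \<open>Real loci of entire functions\<close>

text \<open>By the open mapping theorem the image of a ball around p contains f p + i d and f p - i
  d for some d > 0. Their preimages differ from p, and the punctured ball is connected, so Im f
  vanishes somewhere on it.\<close>

lemma islimpt_real_locus:
  assumes hol: "f holomorphic_on UNIV" and nc: "\<not> f constant_on UNIV" and p: "Im (f p) = 0"
  shows "p islimpt {z. Im (f z) = 0}"
proof (rule ccontr)
  assume "\<not> p islimpt {z. Im (f z) = 0}"
  then obtain e where e: "e > 0" "\<And>z. Im (f z) = 0 \<Longrightarrow> z \<noteq> p \<Longrightarrow> \<not> dist z p < e"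
    by (auto simp: islimpt_approachable)
  let ?B = "ball p e - {p}"
  have "connected ?B"
    by (rule connected_open_delete) auto
  moreover have "continuous_on ?B (\<lambda>z. Im (f z))"
    using hol by (intro continuous_intros) (meson holomorphic_on_imp_continuous_on holomorphic_on_subset subset_UNIV)
  ultimately have conn: "connected ((\<lambda>z. Im (f z)) ` ?B)"
    by (rule connected_continuous_image[rotated])
  have "open (f ` ball p e)"
    by (rule open_mapping_thm[OF hol open_UNIV connected_UNIV open_ball _ nc]) auto
  moreover have "f p \<in> f ` ball p e"
    using e by auto
  ultimately obtain d where d: "d > 0" "cball (f p) d \<subseteq> f ` ball p e"
    by (meson open_contains_cball)
  have in_image: "x \<in> (\<lambda>z. Im (f z)) ` ?B" if "\<bar>x\<bar> = d" for x
  proof -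
    have "f p + \<i> * of_real x \<in> f ` ball p e"
      using d that by (intro subsetD[OF d(2)]) (auto simp: dist_norm norm_mult)
    then obtain z where z: "z \<in> ball p e" "f z = f p + \<i> * of_real x"
      by force
    then have "Im (f z) = x"
      using p by simp
    moreover have "z \<noteq> p"
      using \<open>Im (f z) = x\<close> p d that by auto
    ultimately show ?thesis
      using z by blast
  qed
  have "-d \<in> (\<lambda>z. Im (f z)) ` ?B" "d \<in> (\<lambda>z. Im (f z)) ` ?B"
    using d by (auto intro!: in_image)
  then have "0 \<in> (\<lambda>z. Im (f z)) ` ?B"
    using conn[unfolded connected_iff_interval, rule_format, of "-d" d 0] d(1) by simp
  then obtain z where "z \<in> ?B" "Im (f z) = 0"
    by (metis (no_types, lifting) imageE)
  then show False
    using e(2)[of z] by (simp add: dist_commute)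
qed

text \<open>Every point of the locus is a limit point of it and stays one after finitely many points
  are removed; the locus itself is closed.\<close>

lemma closure_real_locus_minus_finite:
  assumes hol: "f holomorphic_on UNIV" and nc: "\<not> f constant_on UNIV" and F: "finite F"
  shows "closure ({z. Im (f z) = 0} - F) = {z. Im (f z) = 0}"
proof
  have "continuous_on UNIV f"
    using hol by (rule holomorphic_on_imp_continuous_on)
  then have "closed {z. Im (f z) = 0}"
    by (intro closed_Collect_eq continuous_intros)
  then show "closure ({z. Im (f z) = 0} - F) \<subseteq> {z. Im (f z) = 0}"
    by (metis Diff_subset closure_minimal)
next
  show "{z. Im (f z) = 0} \<subseteq> closure ({z. Im (f z) = 0} - F)"
  proof
    fix p assume "p \<in> {z. Im (f z) = 0}"
    then have "p islimpt {z. Im (f z) = 0}"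
      using islimpt_real_locus[OF hol nc, of p] by simp
    then have "p islimpt F \<union> ({z. Im (f z) = 0} - F)"
      by (rule islimpt_subset) auto
    then show "p \<in> closure ({z. Im (f z) = 0} - F)"
      unfolding islimpt_Un_finite[OF F] by (simp add: closure_def)
  qed
qed

section \<open>Real loci of linear and quadratic polynomials\<close>

text \<open>Im (c z) is the real inner product of z with the vector (Im c, Re c), so the locus is a
  hyperplane in a plane.\<close>

lemma real_line_real_locus:
  assumes "c \<noteq> 0"
  shows "real_line {z. Im (d + c * z) = 0}"
proof -
  have eq: "{z. Im (d + c * z) = 0} = {z. Complex (Im c) (Re c) \<bullet> z = - Im d}"
    by (auto simp: inner_complex_def)
  have "Complex (Im c) (Re c) \<noteq> 0"
    using assms by (auto simp: complex_eq_iff)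
  then show ?thesis
    unfolding real_line_def eq by (simp add: affine_hyperplane)
qed

text \<open>The values at m and m + 1 differ by \<alpha>.\<close>

lemma square_not_constant: "(\<alpha>::complex) \<noteq> 0 \<Longrightarrow> \<not> (\<lambda>z. \<alpha> * (z - m)\<^sup>2 + \<beta>) constant_on UNIV"
  by (auto simp: constant_on_def dest: spec[of _ m] spec[of _ "m + 1"])
     (metis add_cancel_left_left add_diff_cancel_left' diff_self mult.right_neutral
        mult_zero_right one_power2 zero_power2)

text \<open>With s^2 = \<alpha> and w = s (z - m), the quadratic term is w^2, whose imaginary part
  is 2 Re w Im w. The equivalence is z \<mapsto> w, split into a real linear map and a
  translation.\<close>

lemma affinely_equivalent_model_curve:
  assumes "\<alpha> \<noteq> 0"
  shows "affinely_equivalent {z. Im (\<alpha> * (z - m)\<^sup>2 + \<beta>) = 0} (model_curve \<beta>)"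
proof -
  define s where "s = csqrt \<alpha>"
  have s: "\<alpha> = s\<^sup>2" "s \<noteq> 0"
    using assms by (auto simp: s_def)
  let ?L = "\<lambda>z. (Re (s * z), Im (s * z))"
  have "linear ?L"
    by (rule linearI) (auto simp: algebra_simps)
  moreover have "bij ?L"
  proof (rule o_bij[where g = "\<lambda>w. Complex (fst w) (snd w) / s"])
    show "(\<lambda>w. Complex (fst w) (snd w) / s) \<circ> ?L = id"
      using s(2) by (simp add: fun_eq_iff del: times_complex.sel)
    show "?L \<circ> (\<lambda>w. Complex (fst w) (snd w) / s) = id"
      using s(2) by (simp add: fun_eq_iff del: times_complex.sel)
  qed
  moreover have "(\<lambda>z. ?L z + ?L (- m)) ` {z. Im (\<alpha> * (z - m)\<^sup>2 + \<beta>) = 0} = model_curve \<beta>"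
  proof -
    have L: "?L z + ?L (- m) = (Re (s * (z - m)), Im (s * (z - m)))" for z
      by (simp add: algebra_simps)
    have Im_eq: "Im (\<alpha> * (z - m)\<^sup>2 + \<beta>) = 2 * Re (s * (z - m)) * Im (s * (z - m)) + Im \<beta>" for z
      unfolding s(1) power_mult_distrib[symmetric] by (simp add: power2_eq_square)
    have "w \<in> (\<lambda>z. ?L z + ?L (- m)) ` {z. Im (\<alpha> * (z - m)\<^sup>2 + \<beta>) = 0}" if "w \<in> model_curve \<beta>" for w
    proof
      have e: "s * (m + Complex (fst w) (snd w) / s - m) = Complex (fst w) (snd w)"
        using s(2) by simp
      show "w = ?L (m + Complex (fst w) (snd w) / s) + ?L (- m)"
        unfolding L e by simp
      show "m + Complex (fst w) (snd w) / s \<in> {z. Im (\<alpha> * (z - m)\<^sup>2 + \<beta>) = 0}"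
        unfolding mem_Collect_eq Im_eq e using that by (auto simp: model_curve_def)
    qed
    moreover have "?L z + ?L (- m) \<in> model_curve \<beta>" if "Im (\<alpha> * (z - m)\<^sup>2 + \<beta>) = 0" for z
      using that unfolding L Im_eq by (simp add: model_curve_def)
    ultimately show ?thesis
      by blast
  qed
  ultimately show ?thesis
    unfolding affinely_equivalent_def by blast
qed

text \<open>In real coordinates the discriminant is 4 |\<alpha>|^2 and the scaled determinant is -4
  |\<alpha>|^2 Im \<beta>. The gradient consists of the imaginary and real parts of 2 \<alpha> (z -
  m), so it vanishes only at m, which is off the curve.\<close>

lemma smooth_hyperbola_real_locus:
  assumes \<alpha>: "\<alpha> \<noteq> 0" and \<beta>: "Im \<beta> \<noteq> 0"
  shows "smooth_hyperbola {z. Im (\<alpha> * (z - m)\<^sup>2 + \<beta>) = 0}"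
proof -
  define a b d e k where "a = Im \<alpha>" and "b = 2 * Re \<alpha>" and "d = Im (- 2 * \<alpha> * m)"
    and "e = Re (- 2 * \<alpha> * m)" and "k = Im (\<alpha> * m\<^sup>2 + \<beta>)"
  note defs = a_def b_def d_def e_def k_def
  have nz: "(Re \<alpha>)\<^sup>2 + (Im \<alpha>)\<^sup>2 > 0"
    using \<alpha> by (simp add: complex_neq_0)
  have "b\<^sup>2 - 4 * a * (- a) = 4 * ((Re \<alpha>)\<^sup>2 + (Im \<alpha>)\<^sup>2)"
    by (simp add: defs algebra_simps power2_eq_square)
  with nz have disc: "b\<^sup>2 - 4 * a * (- a) > 0"
    by simp
  have "4 * a * (- a) * k + b * d * e - a * e\<^sup>2 - (- a) * d\<^sup>2 - k * b\<^sup>2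
      = - 4 * ((Re \<alpha>)\<^sup>2 + (Im \<alpha>)\<^sup>2) * Im \<beta>"
    by (simp add: defs power2_eq_square) algebra
  with nz \<beta> have det: "4 * a * (- a) * k + b * d * e - a * e\<^sup>2 - (- a) * d\<^sup>2 - k * b\<^sup>2 \<noteq> 0"
    by auto
  have eq: "Im (\<alpha> * (z - m)\<^sup>2 + \<beta>) =
      a * (Re z)\<^sup>2 + b * Re z * Im z + (- a) * (Im z)\<^sup>2 + d * Re z + e * Im z + k" for z
    by (simp add: defs algebra_simps power2_eq_square)
  have grad: "2 * a * Re z + b * Im z + d = 2 * Im (\<alpha> * (z - m))"
    "b * Re z + 2 * (- a) * Im z + e = 2 * Re (\<alpha> * (z - m))" for z
    by (simp_all add: defs algebra_simps)
  have regular: "2 * a * Re z + b * Im z + d \<noteq> 0 \<or> b * Re z + 2 * (- a) * Im z + e \<noteq> 0"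
    if "z \<in> {z. Im (\<alpha> * (z - m)\<^sup>2 + \<beta>) = 0}" for z
  proof -
    have "\<alpha> * (z - m) \<noteq> 0"
      using that \<alpha> \<beta> by auto
    then have "Im (\<alpha> * (z - m)) \<noteq> 0 \<or> Re (\<alpha> * (z - m)) \<noteq> 0"
      unfolding complex_eq_iff zero_complex.sel by blast
    then show ?thesis
      unfolding grad by linarith
  qed
  have locus: "{z. Im (\<alpha> * (z - m)\<^sup>2 + \<beta>) = 0} =
      {z. a * (Re z)\<^sup>2 + b * Re z * Im z + (- a) * (Im z)\<^sup>2 + d * Re z + e * Im z + k = 0}"
    by (simp only: eq)
  show ?thesis
    unfolding smooth_hyperbola_def using disc det locus regular by blast
qed

text \<open>For real \<beta> the equation factors as 2 Re w Im w = 0 with w = s (z - m) and s^2 =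
  \<alpha>. The line Re w = 0 is written as Im (i w) = 0, so that
  \<open>real_line_real_locus\<close> covers both lines.\<close>

lemma two_transverse_lines_real_locus:
  assumes \<alpha>: "\<alpha> \<noteq> 0" and \<beta>: "Im \<beta> = 0"
  shows "two_transverse_lines {z. Im (\<alpha> * (z - m)\<^sup>2 + \<beta>) = 0}"
proof -
  define s where "s = csqrt \<alpha>"
  have s: "\<alpha> = s\<^sup>2" "s \<noteq> 0"
    using assms by (auto simp: s_def)
  let ?l = "{z. Im (- s * m + s * z) = 0}" and ?m = "{z. Im (- \<i> * s * m + \<i> * s * z) = 0}"
  have "Im (\<alpha> * (z - m)\<^sup>2 + \<beta>) = 2 * Re (s * (z - m)) * Im (s * (z - m))" for z
    unfolding s(1) power_mult_distrib[symmetric] using \<beta> by (simp add: power2_eq_square)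
  moreover have "Im (- s * m + s * z) = Im (s * (z - m))"
    "Im (- \<i> * s * m + \<i> * s * z) = Re (s * (z - m))" for z
    by (simp_all add: algebra_simps)
  ultimately have "{z. Im (\<alpha> * (z - m)\<^sup>2 + \<beta>) = 0} = ?l \<union> ?m"
    by auto
  moreover have "z = m" if "z \<in> ?l \<inter> ?m" for z
  proof -
    have "s * (z - m) = 0"
      using that by (simp add: complex_eq_iff algebra_simps)
    then show ?thesis
      using s by simp
  qed
  then have "?l \<inter> ?m = {m}"
    by auto
  moreover have "real_line ?l" "real_line ?m"
    using s(2) by (intro real_line_real_locus; simp)+
  ultimately show ?thesis
    unfolding two_transverse_lines_def by blast
qed

section \<open>The locus in the inverse coordinate\<close>

text \<open>Away from p the substitution u = 1/(z - p) turns f into \<alpha> u^2 + \<beta>. What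
  remains is to control the two closures, at z = p and at u = 0.\<close>

lemma in_inverse_coordinate_real_locus:
  assumes \<alpha>: "\<alpha> \<noteq> 0" and f: "\<And>z. z \<noteq> p \<Longrightarrow> f z = \<beta> + \<alpha> / (z - p)\<^sup>2"
    and F: "finite F" "p \<in> F"
  shows "in_inverse_coordinate p (closure ({z. Im (f z) = 0} - F)) =
    {u. Im (\<alpha> * u\<^sup>2 + \<beta>) = 0}"
proof
  let ?K = "{u. Im (\<alpha> * u\<^sup>2 + \<beta>) = 0}" and ?C = "{z. Im (f z) = 0} - F"
  \<comment> \<open>Clearing the denominator by the positive factor |z - p|^4 gives a condition that
    is continuous at p too. Hence \<open>?T\<close> is closed, and the closure of \<open>?C\<close>
    contains no new point except possibly p.\<close>
  let ?T = "{z. Im ((\<beta> * (z - p)\<^sup>2 + \<alpha>) * cnj ((z - p)\<^sup>2)) = 0}"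
  have T: "z \<in> ?T \<longleftrightarrow> Im (f z) = 0" if "z \<noteq> p" for z
  proof -
    have "f z = (\<beta> * (z - p)\<^sup>2 + \<alpha>) / (z - p)\<^sup>2"
      using that by (simp add: f add_divide_distrib)
    also have "\<dots> = (\<beta> * (z - p)\<^sup>2 + \<alpha>) * cnj ((z - p)\<^sup>2) / of_real ((cmod ((z - p)\<^sup>2))\<^sup>2)"
      by (subst complex_div_cnj) simp
    finally show ?thesis
      using that by (simp del: of_real_power)
  qed
  have "closed ?T"
    by (intro closed_Collect_eq continuous_intros)
  moreover have "?C \<subseteq> ?T"
  proof
    fix z assume "z \<in> ?C"
    then show "z \<in> ?T"
      using F T[of z] by (cases "z = p") auto
  qed
  ultimately have CT: "closure ?C \<subseteq> ?T"
    by (rule closure_minimal[rotated])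
  have "1 / (z - p) \<in> ?K" if "z \<in> closure ?C - {p}" for z
  proof -
    have "Im (f z) = 0"
      using that CT T by blast
    then show ?thesis
      using that by (simp add: f power_divide add.commute del: times_complex.sel)
  qed
  moreover have "closed ?K"
    by (intro closed_Collect_eq continuous_intros)
  ultimately show "in_inverse_coordinate p (closure ?C) \<subseteq> ?K"
    unfolding in_inverse_coordinate_def by (intro closure_minimal) auto
  \<comment> \<open>The removed points are u = 0, which corresponds to z at infinity, and the images
    of F. The rest of \<open>?K\<close> is dense in it and has explicit preimages p + 1/u.\<close>
  let ?F = "insert 0 ((\<lambda>z. 1 / (z - p)) ` F)"
  have "?K = closure (?K - ?F)"
    using closure_real_locus_minus_finite[of "\<lambda>z. \<alpha> * (z - 0)\<^sup>2 + \<beta>" ?F] square_not_constant[OF \<alpha>, of 0 \<beta>] F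
    by (simp add: holomorphic_intros)
  also have "\<dots> \<subseteq> in_inverse_coordinate p (closure ?C)"
    unfolding in_inverse_coordinate_def
  proof (intro closure_mono subsetI)
    fix u assume u: "u \<in> ?K - ?F"
    let ?z = "p + 1 / u"
    have u0: "u \<noteq> 0"
      using u by auto
    have inv: "1 / (?z - p) = u"
      by simp
    then have "?z \<notin> F"
      using u by (metis DiffE imageI insertCI)
    moreover have "f ?z = \<beta> + \<alpha> * u\<^sup>2"
      using u0 by (simp add: f power_divide)
    ultimately have "?z \<in> ?C"
      using u by (simp add: add.commute)
    then have "?z \<in> closure ?C - {p}"
      using closure_subset u0 by fastforce
    then show "u \<in> (\<lambda>z. 1 / (z - p)) ` (closure ?C - {p})"
      using inv by (metis imageI)
  qed
  finally show "?K \<subseteq> in_inverse_coordinate p (closure ?C)" .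
qed

section \<open>The node at a double pole\<close>

text \<open>For nonzero t this is the point z with s/(z - p) = 1/t - i c t, a parametrised hyperbola
  with Re times Im equal to -c. Clearing 1/t makes the formula smooth at t = 0, where it gives
  p.\<close>

definition node_branch :: "complex \<Rightarrow> complex \<Rightarrow> real \<Rightarrow> real \<Rightarrow> complex" where
  "node_branch p s c t = p + s * of_real t / (1 - \<i> * of_real (c * t\<^sup>2))"

lemma node_branch_denom_nonzero: "1 - \<i> * of_real x \<noteq> 0"
  by (simp add: complex_eq_iff)

text \<open>At \<open>t = 0\<close> both sides are the junk value of a division by zero.\<close>

lemma inverse_coordinate_node_branch:
  "s \<noteq> 0 \<Longrightarrow> s / (node_branch p s c t - p) = 1 / of_real t - \<i> * of_real (c * t)"
  using node_branch_denom_nonzero[of "c * t\<^sup>2"]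
  by (cases "t = 0") (auto simp: node_branch_def field_simps power2_eq_square)

lemma Re_inverse_coordinate_node_branch:
  "s \<noteq> 0 \<Longrightarrow> Re (s / (node_branch p s c t - p)) = 1 / t"
  unfolding inverse_coordinate_node_branch by (simp add: Re_divide_of_real)

lemma Im_inverse_coordinate_node_branch:
  "s \<noteq> 0 \<Longrightarrow> Im (s / (node_branch p s c t - p)) = - c * t"
  unfolding inverse_coordinate_node_branch by (simp add: Im_divide_of_real)

lemma node_branch_has_vector_derivative:
  "(node_branch p s c has_vector_derivative
     s * (1 + \<i> * of_real (c * t\<^sup>2)) / (1 - \<i> * of_real (c * t\<^sup>2))\<^sup>2) (at t)"
proof -
  have "((\<lambda>z. p + s * z / (1 - \<i> * (of_real c * z\<^sup>2))) has_field_derivative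
     s * (1 + \<i> * of_real (c * t\<^sup>2)) / (1 - \<i> * of_real (c * t\<^sup>2))\<^sup>2) (at (of_real t))"
    using node_branch_denom_nonzero[of "c * t\<^sup>2"]
    by (auto intro!: derivative_eq_intros simp: power2_eq_square algebra_simps)
  from has_vector_derivative_real_field[OF this] show ?thesis
    by (simp add: node_branch_def[abs_def])
qed

lemma vector_derivative_node_branch_0: "vector_derivative (node_branch p s c) (at 0) = s"
  using vector_derivative_at[OF node_branch_has_vector_derivative[of p s c 0]] by simp

text \<open>The branch restricts a holomorphic function to the real axis, so its iterated complex
  derivatives supply all real ones. The first derivative has numerator s (1 + i c t^2), which never
  vanishes.\<close>

lemma smooth_branch_node_branch:
  assumes s: "s \<noteq> 0"
  shows "smooth_branch {-\<epsilon><..<\<epsilon>} (node_branch p s c)"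
proof -
  define G where "G = (\<lambda>z. p + s * z / (1 - \<i> * (of_real c * z\<^sup>2)))"
  define A where "A = {z. 1 - \<i> * (of_real c * z\<^sup>2) \<noteq> 0}"
  have G: "node_branch p s c = (\<lambda>t. G (of_real t))"
    by (simp add: node_branch_def[abs_def] G_def)
  have "open A"
    unfolding A_def by (intro open_Collect_neq continuous_intros)
  have "G holomorphic_on A"
    unfolding G_def A_def by (intro holomorphic_intros) auto
  have A: "of_real t \<in> A" for t
    using node_branch_denom_nonzero[of "c * t\<^sup>2"] by (simp add: A_def)
  let ?D = "\<lambda>n t. (deriv ^^ n) G (of_real t :: complex)"
  have "(?D n has_vector_derivative ?D (Suc n) t) (at t)" for n t
    using holomorphic_derivI[OF holomorphic_higher_deriv[OF \<open>G holomorphic_on A\<close> \<open>open A\<close>] \<open>open A\<close> A]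
    by (intro has_vector_derivative_real_field) simp
  moreover have "?D 0 = node_branch p s c"
    by (simp add: G)
  ultimately have smooth: "\<exists>D. D 0 = node_branch p s c \<and>
      (\<forall>n. \<forall>t\<in>{-\<epsilon><..<\<epsilon>}. (D n has_vector_derivative D (Suc n) t) (at t))"
    by (intro exI[of _ ?D]) blast
  have regular: "vector_derivative (node_branch p s c) (at t) \<noteq> 0" for t
    using s node_branch_denom_nonzero[of "c * t\<^sup>2"] node_branch_denom_nonzero[of "- c * t\<^sup>2"]
    by (simp add: vector_derivative_at[OF node_branch_has_vector_derivative])
  \<comment> \<open>On the closed interval, compactness makes a continuous injection a homeomorphism
    onto its image; this then restricts to the open interval.\<close>
  have "continuous_on {-\<epsilon>..\<epsilon>} (node_branch p s c)"
    unfolding node_branch_def[abs_def] using node_branch_denom_nonzero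
    by (intro continuous_intros) blast
  moreover have "inj_on (node_branch p s c) {-\<epsilon>..\<epsilon>}"
    \<comment> \<open>The parameter is recovered as the inverse of Re (s/(z - p)); division by zero
      yields 0, which covers t = 0.\<close>
    by (rule inj_onI) (metis Re_inverse_coordinate_node_branch[OF s] inverse_eq_divide inverse_inverse_eq)
  ultimately obtain h where
    "homeomorphism {-\<epsilon>..\<epsilon>} (node_branch p s c ` {-\<epsilon>..\<epsilon>}) (node_branch p s c) h"
    using homeomorphism_compact[OF compact_Icc] by blast
  then have "homeomorphism {-\<epsilon><..<\<epsilon>} (node_branch p s c ` {-\<epsilon><..<\<epsilon>}) (node_branch p s c) h"
    by (rule homeomorphism_of_subsets) auto
  with smooth regular show ?thesis
    unfolding smooth_branch_def by blast
qed

text \<open>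
  In the coordinate \<open>u = s / (z - p)\<close>, where \<open>s\<^sup>2 = \<alpha>\<close>, the curve is the hyperbola
  \<open>2 Re u Im u = - Im \<beta>\<close>. The branches at \<open>p\<close> are its two pairs of opposite ends, parametrised
  by \<open>t = 1 / Re u\<close> and \<open>t = 1 / Im u\<close>. The neighbourhood below is described by
  \<open>|Re u| > 1/\<epsilon>\<close> or \<open>|Im u| > 1/\<epsilon>\<close>, so that it meets the curve exactly in \<open>|t| < \<epsilon>\<close>.
\<close>

lemma ordinary_real_node_double_pole:
  assumes \<alpha>: "\<alpha> \<noteq> 0" and pS: "p \<in> S"
    and S: "\<And>z. z \<noteq> p \<Longrightarrow> z \<in> S \<longleftrightarrow> Im (\<beta> + \<alpha> / (z - p)\<^sup>2) = 0"
  shows "ordinary_real_node S p"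
proof -
  define s where "s = csqrt \<alpha>"
  have s: "\<alpha> = s\<^sup>2" "s \<noteq> 0"
    using \<alpha> by (auto simp: s_def)
  define c where "c = Im \<beta> / 2"
  \<comment> \<open>On the curve |Re u| |Im u| = |c|. With |c| \<epsilon>^2 < 1 the two parts cannot
    both exceed 1/\<epsilon>, which separates the branches away from p.\<close>
  define \<epsilon> where "\<epsilon> = 1 / (1 + \<bar>c\<bar>)"
  have \<epsilon>: "\<epsilon> > 0" "\<bar>c\<bar> * \<epsilon>\<^sup>2 < 1"
  proof -
    show "\<epsilon> > 0"
      by (simp add: \<epsilon>_def add_pos_nonneg)
    have "\<bar>c\<bar> < (1 + \<bar>c\<bar>)\<^sup>2"
      by (simp add: power2_sum add_nonneg_pos add_pos_nonneg)
    then show "\<bar>c\<bar> * \<epsilon>\<^sup>2 < 1"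
      by (simp add: \<epsilon>_def power_divide)
  qed
  let ?u = "\<lambda>z. s / (z - p)"
  let ?I = "{-\<epsilon><..<\<epsilon>}"
  \<comment> \<open>Replacing s by -i s turns u into -i u, whose real part is Im u and whose
    imaginary part is -Re u. The product changes sign, hence the parameter -c in the second
    branch.\<close>
  let ?g = "node_branch p s c" and ?h = "node_branch p (- \<i> * s) (- c)"
  have S': "z \<in> S \<longleftrightarrow> Re (?u z) * Im (?u z) = - c" if "z \<noteq> p" for z
  proof -
    have "\<alpha> / (z - p)\<^sup>2 = (?u z)\<^sup>2"
      by (simp add: s power_divide)
    then have "Im (\<beta> + \<alpha> / (z - p)\<^sup>2) = Im \<beta> + 2 * Re (?u z) * Im (?u z)"
      by (simp only: plus_complex.sel Im_power2)
    then show ?thesis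
      unfolding S[OF that] c_def by (auto simp: field_simps)
  qed
  have g0: "?g 0 = p" "?h 0 = p"
    by (simp_all add: node_branch_def)
  have ug: "Re (?u (?g t)) = 1 / t" "Im (?u (?g t)) = - c * t" for t
    using Re_inverse_coordinate_node_branch[OF s(2)] Im_inverse_coordinate_node_branch[OF s(2)]
    by auto
  have rot: "Re (?u z) = - Im ((- \<i> * s) / (z - p))" "Im (?u z) = Re ((- \<i> * s) / (z - p))" for z
  proof -
    have eq: "(- \<i> * s) / (z - p) = - \<i> * ?u z"
      by simp
    have "Re w = - Im (- \<i> * w)" "Im w = Re (- \<i> * w)" for w
      by simp_all
    then show "Re (?u z) = - Im ((- \<i> * s) / (z - p))" "Im (?u z) = Re ((- \<i> * s) / (z - p))"
      unfolding eq by blast+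
  qed
  have uh: "Im (?u (?h t)) = 1 / t" "Re (?u (?h t)) = - c * t" for t
    using Re_inverse_coordinate_node_branch[of "- \<i> * s" p "- c" t]
      Im_inverse_coordinate_node_branch[of "- \<i> * s" p "- c" t] s(2)
    unfolding rot by (simp_all del: minus_mult_left)
  \<comment> \<open>This includes p, where \<open>?u\<close> has the default value 0, taken nowhere
    else.\<close>
  have u_inj: "z = w" if "?u z = ?u w" for z w
    using that s(2) by (auto simp: divide_simps split: if_splits)
  have g_iff: "z \<in> ?g ` ?I \<longleftrightarrow> z = p \<or> z \<in> S \<and> \<bar>Re (?u z)\<bar> > 1 / \<epsilon>" for z
  proof
    assume "z \<in> ?g ` ?I"
    then obtain t where t: "z = ?g t" "\<bar>t\<bar> < \<epsilon>"
      by (auto simp: abs_less_iff)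
    show "z = p \<or> z \<in> S \<and> \<bar>Re (?u z)\<bar> > 1 / \<epsilon>"
    proof (cases "t = 0")
      case False
      then have "z \<noteq> p"
        using ug(1)[of t] t by auto
      then have "z \<in> S"
        unfolding S'[OF \<open>z \<noteq> p\<close>] unfolding t ug using False by simp
      moreover have "\<bar>Re (?u z)\<bar> > 1 / \<epsilon>"
        unfolding t ug using False t(2) by (simp add: frac_less2)
      ultimately show ?thesis by blast
    qed (use t g0 in simp)
  next
    assume "z = p \<or> z \<in> S \<and> \<bar>Re (?u z)\<bar> > 1 / \<epsilon>"
    then show "z \<in> ?g ` ?I"
    proof
      assume z: "z \<in> S \<and> \<bar>Re (?u z)\<bar> > 1 / \<epsilon>"
      define t where "t = 1 / Re (?u z)"
      have big: "\<bar>Re (?u z)\<bar> > 1 / \<epsilon>" "Re (?u z) \<noteq> 0"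
        using z \<epsilon> by (auto simp: less_le_trans)
      then have "z \<noteq> p" by auto
      have "\<bar>t\<bar> < \<epsilon>"
        using big \<epsilon> by (simp add: t_def field_simps)
      moreover have "Re (?u z) * Im (?u z) = - c"
        using z S'[OF \<open>z \<noteq> p\<close>] by blast
      then have "Im (?u z) = - c * t"
        using big by (simp add: t_def field_simps)
      then have "?u z = ?u (?g t)"
        by (intro complex_eqI) (simp_all only: ug, simp add: t_def)
      then have "z = ?g t"
        by (rule u_inj)
      ultimately show ?thesis
        by (auto simp: abs_less_iff)
    qed (use g0 \<epsilon> in \<open>auto intro!: image_eqI[of _ _ 0]\<close>)
  qed
  have h_iff: "z \<in> ?h ` ?I \<longleftrightarrow> z = p \<or> z \<in> S \<and> \<bar>Im (?u z)\<bar> > 1 / \<epsilon>" for z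
  proof
    assume "z \<in> ?h ` ?I"
    then obtain t where t: "z = ?h t" "\<bar>t\<bar> < \<epsilon>"
      by (auto simp: abs_less_iff)
    show "z = p \<or> z \<in> S \<and> \<bar>Im (?u z)\<bar> > 1 / \<epsilon>"
    proof (cases "t = 0")
      case False
      then have "z \<noteq> p"
        using uh(1)[of t] t by auto
      then have "z \<in> S"
        unfolding S'[OF \<open>z \<noteq> p\<close>] unfolding t uh using False by simp
      moreover have "\<bar>Im (?u z)\<bar> > 1 / \<epsilon>"
        unfolding t uh using False t(2) by (simp add: frac_less2)
      ultimately show ?thesis by blast
    qed (use t g0 in simp)
  next
    assume "z = p \<or> z \<in> S \<and> \<bar>Im (?u z)\<bar> > 1 / \<epsilon>"
    then show "z \<in> ?h ` ?I"
    proof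
      assume z: "z \<in> S \<and> \<bar>Im (?u z)\<bar> > 1 / \<epsilon>"
      define t where "t = 1 / Im (?u z)"
      have big: "\<bar>Im (?u z)\<bar> > 1 / \<epsilon>" "Im (?u z) \<noteq> 0"
        using z \<epsilon> by (auto simp: less_le_trans)
      then have "z \<noteq> p" by auto
      have "\<bar>t\<bar> < \<epsilon>"
        using big \<epsilon> by (simp add: t_def field_simps)
      moreover have "Re (?u z) * Im (?u z) = - c"
        using z S'[OF \<open>z \<noteq> p\<close>] by blast
      then have "Re (?u z) = - c * t"
        using big by (simp add: t_def field_simps)
      then have "?u z = ?u (?h t)"
        by (intro complex_eqI) (simp_all only: uh, simp add: t_def)
      then have "z = ?h t"
        by (rule u_inj)
      ultimately show ?thesis
        by (auto simp: abs_less_iff)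
    qed (use g0 \<epsilon> in \<open>auto intro!: image_eqI[of _ _ 0]\<close>)
  qed
  \<comment> \<open>Within this radius |u| > 2/\<epsilon>, so |Re u| or |Im u| exceeds 1/\<epsilon>.
    The punctured ball thus lies in V, and adding the ball makes the neighbourhood open at p without
    bringing in any other point.\<close>
  define r where "r = \<epsilon> * cmod s / 2"
  define V where "V = {z. z \<noteq> p \<and> (\<bar>Re (?u z)\<bar> > 1 / \<epsilon> \<or> \<bar>Im (?u z)\<bar> > 1 / \<epsilon>)}"
  have "V = -{p} \<inter> (\<lambda>z. max \<bar>Re (?u z)\<bar> \<bar>Im (?u z)\<bar>) -` {1 / \<epsilon><..}"
    by (auto simp: V_def less_max_iff_disj)
  moreover have "open \<dots>"
    by (intro continuous_open_preimage continuous_intros) auto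
  ultimately have "open V"
    by simp
  have ball: "z \<in> V" if "z \<in> ball p r" "z \<noteq> p" for z
  proof -
    have "0 < cmod (z - p)" "cmod (z - p) < r"
      using that by (auto simp: dist_norm norm_minus_commute)
    then have "2 / \<epsilon> < cmod (?u z)"
      using \<epsilon>(1) by (simp add: r_def norm_divide field_simps)
    also have "\<dots> \<le> \<bar>Re (?u z)\<bar> + \<bar>Im (?u z)\<bar>"
      by (rule cmod_le)
    finally have "1 / \<epsilon> + 1 / \<epsilon> < \<bar>Re (?u z)\<bar> + \<bar>Im (?u z)\<bar>"
      by simp
    then show ?thesis
      using that(2) unfolding V_def by (simp del: divide_inverse) linarith
  qed
  let ?U = "ball p r \<union> V"
  have "r > 0"
    using \<epsilon> s by (simp add: r_def)
  have "S \<inter> ?U = ?g ` ?I \<union> ?h ` ?I"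
  proof (rule set_eqI)
    fix z show "z \<in> S \<inter> ?U \<longleftrightarrow> z \<in> ?g ` ?I \<union> ?h ` ?I"
      unfolding Un_iff g_iff h_iff using ball[of z] pS \<open>r > 0\<close> by (cases "z = p") (auto simp: V_def)
  qed
  moreover have "?g ` ?I \<inter> ?h ` ?I = {p}"
  proof (rule set_eqI)
    fix z
    have False if z: "z \<noteq> p" "z \<in> S" "\<bar>Re (?u z)\<bar> > 1 / \<epsilon>" "\<bar>Im (?u z)\<bar> > 1 / \<epsilon>"
    proof -
      have "(1 / \<epsilon>) * (1 / \<epsilon>) \<le> \<bar>Re (?u z)\<bar> * \<bar>Im (?u z)\<bar>"
        using z \<epsilon> by (intro mult_mono) auto
      also have "\<dots> = \<bar>c\<bar>"
        using z(2) S'[OF z(1)] by (metis abs_minus_cancel abs_mult)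
      finally show False
        using \<epsilon> by (simp add: field_simps power2_eq_square)
    qed
    then show "z \<in> ?g ` ?I \<inter> ?h ` ?I \<longleftrightarrow> z \<in> {p}"
      unfolding Int_iff g_iff h_iff by auto
  qed
  moreover have "smooth_branch ?I ?g" "smooth_branch ?I ?h"
    using s by (auto intro!: smooth_branch_node_branch)
  \<comment> \<open>The tangents s and -i s have ratio i, so no real multiple of one is the
    other.\<close>
  moreover have not_parallel: "s \<noteq> k *\<^sub>R (- \<i> * s)" for k
  proof
    assume "s = k *\<^sub>R (- \<i> * s)"
    then have "s * (1 + of_real k * \<i>) = 0"
      by (simp add: scaleR_conv_of_real algebra_simps eq_neg_iff_add_eq_0)
    moreover have "1 + of_real k * \<i> \<noteq> 0"
      by (simp add: complex_eq_iff)
    ultimately show False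
      using s(2) by simp
  qed
  have "s \<noteq> - \<i> * s"
    using not_parallel[of 1] by simp
  moreover have "independent {s, - \<i> * s}"
    using not_parallel s(2) by (auto simp: independent_insert span_singleton)
  moreover have "open ?U" "p \<in> ?U"
    using \<open>open V\<close> \<open>r > 0\<close> by auto
  ultimately show ?thesis
    unfolding ordinary_real_node_def using g0 \<epsilon>(1)
    by (intro exI[of _ ?U] exI[of _ \<epsilon>] exI[of _ ?g] exI[of _ ?h]) 
      (simp only: vector_derivative_node_branch_0 simp_thms)
qed

section \<open>Inflection curves of degree at most two\<close>

lemma inflection_curve_eq_closure:
  assumes "rat_degree (rat_deriv R) \<noteq> 0"
  obtains F where "finite F" "\<And>z. poly (rat_den R) z = 0 \<Longrightarrow> z \<in> F"
    "inflection_curve R = closure ({z. Im (rat_eval (rat_deriv R) z) = 0} - F)"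
proof
  let ?F = "{z. poly (rat_num R) z = 0} \<union> {z. poly (rat_den R) z = 0}"
  \<comment> \<open>If R were zero, its derivative would be zero, of degree 0; a nonzero numerator
    makes the excluded set finite.\<close>
  have "rat_num R \<noteq> 0"
  proof
    assume "rat_num R = 0"
    then have "rat_deriv R = to_fract 0"
      by (simp add: rat_deriv_def fract_collapse)
    with assms show False
      by (simp only: rat_degree_def rat_num_to_fract rat_den_to_fract) simp
  qed
  then show "finite ?F"
    by (simp add: poly_roots_finite)
  show "inflection_curve R = closure ({z. Im (rat_eval (rat_deriv R) z) = 0} - ?F)"
    unfolding inflection_curve_def by (rule arg_cong[of _ _ closure]) auto
qed auto

lemma inflection_curve_polynomial:
  assumes f: "rat_deriv R = to_fract q" and deg: "degree q \<noteq> 0"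
  shows "inflection_curve R = {z. Im (poly q z) = 0}"
proof -
  have "rat_degree (rat_deriv R) \<noteq> 0"
    using deg by (simp add: f rat_degree_def)
  then obtain F where "finite F"
    "inflection_curve R = closure ({z. Im (rat_eval (rat_deriv R) z) = 0} - F)"
    by (rule inflection_curve_eq_closure)
  moreover have "\<not> poly q constant_on UNIV"
    using deg unfolding constant_on_def constant_degree[symmetric] constant_def by (metis UNIV_I)
  ultimately show ?thesis
    by (simp add: f rat_eval_def closure_real_locus_minus_finite poly_holomorphic_on)
qed

section \<open>Classification by degree and pole\<close>

text \<open>A double pole makes the reduced denominator quadratic, so degree one leaves only the
  polynomial case.\<close>

lemma rat_deriv_degree_1:
  assumes deg: "rat_degree (rat_deriv R) = 1"
  shows "(\<exists>q. degree q = 1 \<and> rat_deriv R = to_fract q) \<and> real_line (inflection_curve R)"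
proof -
  have "rat_degree (rat_deriv R) \<le> 2"
    using deg by simp
  then show ?thesis
  proof (cases rule: rat_deriv_cases)
    case (polynomial q)
    with deg have q: "degree q = 1"
      by simp
    then obtain d c b where "q = [:d, c, b:]"
      using degree_le_2E[of q] by auto
    with q have "q = [:d, c:]" "c \<noteq> 0"
      by (auto split: if_splits)
    then have "real_line {z. Im (poly q z) = 0}"
      using real_line_real_locus[of c d] by (simp add: mult.commute)
    then show ?thesis
      using polynomial q inflection_curve_polynomial[OF polynomial(1)] by auto
  next
    case (double_pole p)
    then have "degree (rat_den (rat_deriv R)) = 2"
      by (simp add: power2_eq_square)
    with deg show ?thesis
      by (simp add: rat_degree_def)
  qed
qed

lemma rat_deriv_quadratic:
  assumes f: "rat_deriv R = to_fract q" and deg: "degree q = 2"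
  shows "\<exists>a b \<alpha> \<beta>. a \<noteq> 0 \<and> \<alpha> \<noteq> 0 \<and>
    (\<forall>z. rat_eval (rat_deriv R) (a * z + b) = \<alpha> * z\<^sup>2 + \<beta>) \<and>
    affinely_equivalent (inflection_curve R) (model_curve \<beta>) \<and>
    (Im \<beta> \<noteq> 0 \<longrightarrow> smooth_hyperbola (inflection_curve R)) \<and>
    (Im \<beta> = 0 \<longrightarrow> two_transverse_lines (inflection_curve R))"
proof -
  obtain c0 c1 \<alpha> where q: "q = [:c0, c1, \<alpha>:]"
    using degree_le_2E[of q] deg by auto
  with deg have \<alpha>: "\<alpha> \<noteq> 0"
    by (auto split: if_splits)
  \<comment> \<open>Completing the square: m is the critical point of the polynomial and \<beta> its
    critical value.\<close>
  define m \<beta> where "m = - c1 / (2 * \<alpha>)" and "\<beta> = c0 - \<alpha> * m\<^sup>2"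
  have "c1 = - 2 * \<alpha> * m"
    using \<alpha> by (simp add: m_def)
  then have poly_q: "poly q z = \<alpha> * (z - m)\<^sup>2 + \<beta>" for z
    by (simp add: q \<beta>_def algebra_simps power2_eq_square)
  have curve: "inflection_curve R = {z. Im (\<alpha> * (z - m)\<^sup>2 + \<beta>) = 0}"
    using inflection_curve_polynomial[OF f] deg by (simp only: poly_q)
  have "rat_eval (rat_deriv R) (1 * z + m) = \<alpha> * z\<^sup>2 + \<beta>" for z
    by (simp add: f rat_eval_def poly_q)
  moreover have "affinely_equivalent (inflection_curve R) (model_curve \<beta>)"
    unfolding curve using \<alpha> by (rule affinely_equivalent_model_curve)
  moreover have "Im \<beta> \<noteq> 0 \<longrightarrow> smooth_hyperbola (inflection_curve R)"
    unfolding curve using \<alpha> smooth_hyperbola_real_locus by blast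
  moreover have "Im \<beta> = 0 \<longrightarrow> two_transverse_lines (inflection_curve R)"
    unfolding curve using \<alpha> two_transverse_lines_real_locus by blast
  ultimately show ?thesis
    using \<alpha> one_neq_zero[where 'a = complex] by blast
qed

lemma rat_deriv_double_pole:
  assumes D: "rat_den (rat_deriv R) = [:-p, 1:]\<^sup>2" and P: "rat_den R = [:-p, 1:]"
    and deg: "rat_degree (rat_deriv R) \<le> 2"
  shows "\<exists>\<alpha> \<beta>. finite_poles (rat_deriv R) = {p} \<and> pole_order (rat_deriv R) p = 2 \<and> \<alpha> \<noteq> 0 \<and>
    (\<forall>z. z \<noteq> p \<longrightarrow> rat_eval (rat_deriv R) z = \<beta> + \<alpha> / (z - p)\<^sup>2) \<and>
    affinely_equivalent (in_inverse_coordinate p (inflection_curve R)) (model_curve \<beta>) \<and>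
    ordinary_real_node (finite_part (projective_dessin (rat_deriv R))) p"
proof -
  obtain \<alpha> \<beta> where \<alpha>: "\<alpha> \<noteq> 0"
    and eval: "\<And>z. z \<noteq> p \<Longrightarrow> rat_eval (rat_deriv R) z = \<beta> + \<alpha> / (z - p)\<^sup>2"
    using rat_eval_double_pole[OF D P deg] by metis
  have poles: "finite_poles (rat_deriv R) = {p}"
    by (auto simp: finite_poles_def D)
  have order: "pole_order (rat_deriv R) p = 2"
    by (simp add: pole_order_def D order_power_n_n)
  have "rat_degree (rat_deriv R) \<noteq> 0"
    by (simp add: rat_degree_def D power2_eq_square)
  then obtain F where F: "finite F" "\<And>z. poly (rat_den R) z = 0 \<Longrightarrow> z \<in> F"
    and curve: "inflection_curve R = closure ({z. Im (rat_eval (rat_deriv R) z) = 0} - F)"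
    by (rule inflection_curve_eq_closure) blast
  \<comment> \<open>The default value 0 of \<open>rat_eval\<close> at p is real, so p satisfies the
    real condition formally; as a root of \<open>rat_den R\<close> it is among the points removed
    before taking the closure.\<close>
  have "p \<in> F"
    by (rule F(2)) (simp add: P)
  then have "in_inverse_coordinate p (inflection_curve R) = {u. Im (\<alpha> * (u - 0)\<^sup>2 + \<beta>) = 0}"
    unfolding curve using in_inverse_coordinate_real_locus[OF \<alpha> eval F(1)] by simp
  then have aff: "affinely_equivalent (in_inverse_coordinate p (inflection_curve R)) (model_curve \<beta>)"
    using affinely_equivalent_model_curve[OF \<alpha>] by metis
  let ?S = "finite_part (projective_dessin (rat_deriv R))"
  \<comment> \<open>The pole p belongs to the dessin because \<open>rat_map\<close> sends it to
    infinity, a point of \<open>real_proj_line\<close>.\<close>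
  have S: "z \<in> ?S \<longleftrightarrow> z = p \<or> Im (rat_eval (rat_deriv R) z) = 0" for z
    by (auto simp: finite_part_def projective_dessin_def rat_map_def real_proj_line_def poles
        complex_is_Real_iff)
  have "ordinary_real_node ?S p"
    using \<alpha> by (rule ordinary_real_node_double_pole[where \<beta> = \<beta>]) (simp_all only: S eval simp_thms)
  with \<alpha> eval poles order aff show ?thesis
    by blast
qed

theorem proposition9p1:
  fixes R f :: ratfun
  assumes f_def: "f = rat_deriv R"
    and deg_le: "rat_degree f \<le> 2"
  shows
    "(rat_degree f = 1 \<longrightarrow>
        (\<exists>q. degree q = 1 \<and> f = to_fract q) \<and> real_line (inflection_curve R)) \<and>
     (rat_degree f = 2 \<longrightarrow>
        (let quadratic = (\<exists>q. degree q = 2 \<and> f = to_fract q);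
             one_pole = (\<exists>!p. p \<in> finite_poles f)
         in (quadratic \<or> one_pole) \<and> \<not> (quadratic \<and> one_pole) \<and>
            (quadratic \<longrightarrow>
               (\<exists>a b \<alpha> \<beta>. a \<noteq> 0 \<and> \<alpha> \<noteq> 0 \<and>
                  (\<forall>z. rat_eval f (a * z + b) = \<alpha> * z\<^sup>2 + \<beta>) \<and>
                  affinely_equivalent (inflection_curve R) (model_curve \<beta>) \<and>
                  (Im \<beta> \<noteq> 0 \<longrightarrow> smooth_hyperbola (inflection_curve R)) \<and>
                  (Im \<beta> = 0 \<longrightarrow> two_transverse_lines (inflection_curve R)))) \<and>
            (one_pole \<longrightarrow>
               (\<exists>p \<alpha> \<beta>. finite_poles f = {p} \<and> pole_order f p = 2 \<and> \<alpha> \<noteq> 0 \<and>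
                  (\<forall>z. z \<noteq> p \<longrightarrow> rat_eval f z = \<beta> + \<alpha> / (z - p)\<^sup>2) \<and>
                  affinely_equivalent (in_inverse_coordinate p (inflection_curve R))
                    (model_curve \<beta>) \<and>
                  ordinary_real_node (finite_part (projective_dessin f)) p))))"
proof -
  \<comment> \<open>A polynomial has reduced denominator 1; this makes the two alternatives exclude
    each other.\<close>
  have quadratic: "finite_poles f = {}" if "f = to_fract q" for q
    using that by (simp add: finite_poles_def)
  have deg: "rat_degree (rat_deriv R) \<le> 2"
    using deg_le by (simp add: f_def)
  have double_pole: "(\<exists>!p. p \<in> finite_poles f)"
    if "rat_den (rat_deriv R) = [:-p, 1:]\<^sup>2" for p
    using that by (auto simp: f_def finite_poles_def)
  have cases: "(\<exists>q. degree q = 2 \<and> f = to_fract q) \<or> (\<exists>!p. p \<in> finite_poles f)"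
    if "rat_degree f = 2"
    using deg by (cases rule: rat_deriv_cases) (use that double_pole f_def in auto)
  have one_pole: "\<exists>p \<alpha> \<beta>. finite_poles f = {p} \<and> pole_order f p = 2 \<and> \<alpha> \<noteq> 0 \<and>
      (\<forall>z. z \<noteq> p \<longrightarrow> rat_eval f z = \<beta> + \<alpha> / (z - p)\<^sup>2) \<and>
      affinely_equivalent (in_inverse_coordinate p (inflection_curve R)) (model_curve \<beta>) \<and>
      ordinary_real_node (finite_part (projective_dessin f)) p"
    if "\<exists>!p. p \<in> finite_poles f"
    using deg
  proof (cases rule: rat_deriv_cases)
    case (polynomial q)
    with that quadratic[of q] show ?thesis
      by (auto simp: f_def)
  next
    case (double_pole p)
    with rat_deriv_double_pole[OF double_pole deg] show ?thesis
      unfolding f_def by blast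
  qed
  have "\<not> ((\<exists>q. degree q = 2 \<and> f = to_fract q) \<and> (\<exists>!p. p \<in> finite_poles f))"
    using quadratic by auto
  with cases one_pole show ?thesis
    using rat_deriv_degree_1[of R] rat_deriv_quadratic[of R]
    unfolding Let_def f_def by blast
qed

end
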